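(* Let $I,J\subset\mathbb{N}$ be disjoint infinite sets with $I\cup J=\mathbb{N}$. For each $j\in J$ fix a function $\varphi_j:\{0,\dots,p-1\}^j\to\{0,\dots,p-1\}$. For $\gamma\ge0$ define $$C_\gamma=\Big\{\sum_{i=0}^{\gamma-1}t_ip^i:\ t_i\in\{0,\dots,p-1\},\ t_j=\varphi_j(t_0,\dots,t_{j-1})\text{ for all }j\in J,\ j<\gamma\Big\}\subset\mathbb{Z}_p$$ and $\Omega_\gamma=\bigsqcup_{c\in C_\gamma}(c+p^\gamma\mathbb{Z}_p)$. Then $\Omega_0\supset\Omega_1\supset\cdots$. The probability measures $\mathfrak{m}|_{\Omega_\gamma}/\mathfrak{m}(\Omega_\gamma)$ converge weakly to a probability measure $\mu_{I,J}$, which is singular with respect to $\mathfrak{m}$. Moreover, $\mu_{I,J}$ is a spectral measure with spectrum $$\Lambda=\Big\{\sum_{i\in I}b_ip^{-i-1}:\ b_i\in\{0,\dots,p-1\},\ \text{only finitely many }b_i\neq0\Big\}.$$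
   Context: $p\ge2$ is a prime and $\mathbb{N}=\{0,1,2,\dots\}$. $\mathbb{Q}_p$ and $\mathbb{Z}_p$ are the $p$-adic numbers and $p$-adic integers, with valuation $v_p$. $\mathfrak{m}$ is the Haar measure on $\mathbb{Q}_p$ with $\mathfrak{m}(\mathbb{Z}_p)=1$. Characters: $\chi(x)=e^{2\pi i\{x\}}$, where $\{x\}=\sum_{n=v_p(x)}^{-1}a_np^n$ is the fractional part of $x=\sum_{n\ge v_p(x)}a_np^n$ with digits $a_n\in\{0,\dots,p-1\}$. Also $\chi_y(x)=\chi(yx)$. Spectral measure: a Borel probability measure $\mu$ is spectral with spectrum $\Lambda$ if $\{\chi_\lambda\}_{\lambda\in\Lambda}$ is an orthonormal basis of $L^2(\mu)$. *)

theory Defs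
  imports "HOL-Probability.Probability"
begin

text \<open>Model of the p-adic integers: a p-adic integer x = sum_n a_n p^n is identified
  with its digit sequence n -> a_n, digits in {0..p-1}.\<close>

definition Zp :: "nat \<Rightarrow> (nat \<Rightarrow> nat) set" where
  "Zp p = {x. \<forall>n. x n < p}"

definition Zp_top :: "nat \<Rightarrow> (nat \<Rightarrow> nat) topology" where
  "Zp_top p = product_topology (\<lambda>_. discrete_topology {..<p}) UNIV"

text \<open>Haar measure m restricted to Z_p (m(Z_p) = 1): i.i.d. uniform digits.
  Its sigma-algebra is the product sigma-algebra = Borel sets of Zp_top.\<close>
definition Haar :: "nat \<Rightarrow> (nat \<Rightarrow> nat) measure" where
  "Haar p = PiM UNIV (\<lambda>_::nat. uniform_count_measure {..<p})"

text \<open>Ball c + p^g Z_p, where c = sum_{i<g} t_i p^i is given by its digits t.\<close>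
definition cyl :: "nat \<Rightarrow> nat \<Rightarrow> (nat \<Rightarrow> nat) \<Rightarrow> (nat \<Rightarrow> nat) set" where
  "cyl p g t = {x \<in> Zp p. \<forall>i<g. x i = t i}"

text \<open>C_g, each element c = sum_{i<g} t_i p^i represented by its digit sequence t
  (t_i = 0 for i >= g).\<close>
definition C :: "nat \<Rightarrow> nat set \<Rightarrow> (nat \<Rightarrow> nat list \<Rightarrow> nat) \<Rightarrow> nat \<Rightarrow> (nat \<Rightarrow> nat) set" where
  "C p J \<phi> g = {t. (\<forall>i<g. t i < p) \<and> (\<forall>i\<ge>g. t i = 0) \<and>
      (\<forall>j\<in>J. j < g \<longrightarrow> t j = \<phi> j (map t [0..<j]))}"

definition Omega :: "nat \<Rightarrow> nat set \<Rightarrow> (nat \<Rightarrow> nat list \<Rightarrow> nat) \<Rightarrow> nat \<Rightarrow> (nat \<Rightarrow> nat) set" where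
  "Omega p J \<phi> g = (\<Union>t\<in>C p J \<phi> g. cyl p g t)"

definition weak_conv_Zp :: "nat \<Rightarrow> (nat \<Rightarrow> (nat \<Rightarrow> nat) measure) \<Rightarrow> (nat \<Rightarrow> nat) measure \<Rightarrow> bool" where
  "weak_conv_Zp p Ms \<mu> \<longleftrightarrow>
     (\<forall>f. continuous_map (Zp_top p) euclideanreal f \<longrightarrow>
        (\<lambda>n. \<integral>x. f x \<partial>(Ms n)) \<longlonglongrightarrow> (\<integral>x. f x \<partial>\<mu>))"

definition singular :: "'a measure \<Rightarrow> 'a measure \<Rightarrow> bool" where
  "singular \<mu> \<nu> \<longleftrightarrow> (\<exists>A\<in>sets \<nu>. emeasure \<nu> A = 0 \<and> emeasure \<mu> (space \<mu> - A) = 0)"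

text \<open>Lambda: lambda = sum_{i in I} b_i p^(-i-1), represented by its coefficient sequence b
  (finitely supported, b_i = 0 outside I). Distinct b give distinct lambda.\<close>
definition Lam :: "nat \<Rightarrow> nat set \<Rightarrow> (nat \<Rightarrow> nat) set" where
  "Lam p I = {b. (\<forall>i. b i < p) \<and> finite {i. b i \<noteq> 0} \<and> (\<forall>i. i \<notin> I \<longrightarrow> b i = 0)}"

definition trunc :: "nat \<Rightarrow> (nat \<Rightarrow> nat) \<Rightarrow> nat \<Rightarrow> nat" where
  "trunc p x k = (\<Sum>n<k. x n * p ^ n)"

text \<open>The p-adic fractional part of lambda*x for lambda = sum_i b_i p^(-i-1), x in Z_p:
  lambda*x is congruent mod Z_p to sum_i b_i (x mod p^(i+1)) / p^(i+1), a rational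
  in Z[1/p]; its p-adic fractional part is the real fractional part of that number.\<close>
definition padic_frac_prod :: "nat \<Rightarrow> (nat \<Rightarrow> nat) \<Rightarrow> (nat \<Rightarrow> nat) \<Rightarrow> real" where
  "padic_frac_prod p b x =
     frac (\<Sum>i\<in>{i. b i \<noteq> 0}. real (b i) * real (trunc p x (Suc i)) / real p ^ Suc i)"

definition chi :: "nat \<Rightarrow> (nat \<Rightarrow> nat) \<Rightarrow> (nat \<Rightarrow> nat) \<Rightarrow> complex" where
  "chi p b x = cis (2 * pi * padic_frac_prod p b x)"

text \<open>{chi_lambda}_{lambda in Lambda} is an orthonormal basis of L^2(mu): orthonormal,
  and complete (only the zero element of L^2 is orthogonal to all of them).\<close>
definition spectral_with :: "nat \<Rightarrow> (nat \<Rightarrow> nat) measure \<Rightarrow> (nat \<Rightarrow> nat) set \<Rightarrow> bool" where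
  "spectral_with p \<mu> \<Lambda> \<longleftrightarrow>
     (\<forall>b\<in>\<Lambda>. chi p b \<in> borel_measurable \<mu>) \<and>
     (\<forall>b\<in>\<Lambda>. \<forall>b'\<in>\<Lambda>. (\<integral>x. chi p b x * cnj (chi p b' x) \<partial>\<mu>) = (if b = b' then 1 else 0)) \<and>
     (\<forall>f::(nat \<Rightarrow> nat) \<Rightarrow> complex. f \<in> borel_measurable \<mu> \<longrightarrow>
        integrable \<mu> (\<lambda>x. (cmod (f x))\<^sup>2) \<longrightarrow>
        (\<forall>b\<in>\<Lambda>. (\<integral>x. f x * cnj (chi p b x) \<partial>\<mu>) = 0) \<longrightarrow>
        (AE x in \<mu>. f x = 0))"

end

theory Submission
  imports Defs
begin

text \<open>
  Let \<open>T\<close> be the map on digit sequences that keeps the digits at positions in \<open>I\<close> and replaces,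
  from left to right, each digit at a position \<open>j \<in> J\<close> by the value of \<open>\<phi> j\<close> on the digits already
  computed. The measure \<open>\<mu>\<close> is the image of Haar measure under \<open>T\<close>. Performing the replacement only
  at positions below \<open>g\<close> produces exactly the normalised Haar measure on \<open>Omega g\<close>, so weak
  convergence is dominated convergence; and \<open>Omega g\<close> has Haar measure \<open>p\<close> to the power
  \<open>- card (J \<inter> {..<g})\<close>, which tends to 0, whence singularity.

  Orthogonality: if \<open>i\<close> is the last position where \<open>b\<close> and \<open>b'\<close> differ, then \<open>i \<in> I\<close>, and
  incrementing the digit of \<open>x\<close> at \<open>i\<close> modulo \<open>p\<close> preserves Haar measure but multiplies
  \<open>chi b * cnj (chi b')\<close> at \<open>T x\<close> by a nontrivial root of unity.

  Completeness: for admissible \<open>x\<close> and \<open>y\<close>, summing \<open>chi b x * cnj (chi b y)\<close> over the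
  frequencies supported below \<open>g\<close> gives a product of geometric sums. It vanishes if \<open>x\<close> and \<open>y\<close>
  differ below \<open>g\<close>, because the first position where they differ must lie in \<open>I\<close>. So indicators of
  balls are combinations of characters almost everywhere, and a function orthogonal to all
  characters has zero integral over every ball.
\<close>

subsection \<open>Sets determined by finitely many digits\<close>

text \<open>Padding with zeros matches the representatives used in \<open>C\<close> and the finite
  support required by \<open>Lam\<close>, so one operation serves both for ball centres and for
  frequencies.\<close>

definition head :: "nat \<Rightarrow> (nat \<Rightarrow> nat) \<Rightarrow> nat \<Rightarrow> nat" where
  "head k x = (\<lambda>i. if i < k then x i else 0)"

text \<open>For fixed \<open>k\<close> these sets are the unions of cosets of p^k Z_p; over all
  \<open>k\<close> they are the clopen subsets of the p-adic integers.\<close>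

definition digit_det :: "nat \<Rightarrow> nat \<Rightarrow> (nat \<Rightarrow> nat) set \<Rightarrow> bool" where
  "digit_det p k A \<longleftrightarrow> A \<subseteq> Zp p \<and> (\<forall>x\<in>A. \<forall>y\<in>Zp p. (\<forall>i<k. x i = y i) \<longrightarrow> y \<in> A)"

lemma digit_det_mono: "digit_det p k A \<Longrightarrow> k \<le> l \<Longrightarrow> digit_det p l A"
  unfolding digit_det_def by auto

lemma head_in_Zp: "p > 0 \<Longrightarrow> x \<in> Zp p \<Longrightarrow> head k x \<in> Zp p"
  by (simp add: head_def Zp_def)

lemma finite_head_image: "A \<subseteq> Zp p \<Longrightarrow> finite (head k ` A)"
proof (rule finite_subset)
  assume A: "A \<subseteq> Zp p"
  \<comment> \<open>Members of \<open>PiE\<close> are \<open>undefined\<close> from \<open>k\<close>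
    on rather than 0; a second application of \<open>head k\<close> reconciles the two
    conventions.\<close>
  show "head k ` A \<subseteq> head k ` (PiE {..<k} (\<lambda>_. {..<p}))"
  proof
    fix t assume "t \<in> head k ` A"
    then obtain x where x: "x \<in> A" "t = head k x" by auto
    have "head k x = head k (restrict x {..<k})" by (auto simp: head_def)
    moreover have "restrict x {..<k} \<in> PiE {..<k} (\<lambda>_. {..<p})"
      using A x by (auto simp: Zp_def)
    ultimately show "t \<in> head k ` (PiE {..<k} (\<lambda>_. {..<p}))" using x by blast
  qed
qed (intro finite_imageI finite_PiE; simp)

lemma digit_det_eq_UN_cyl:
  assumes "digit_det p k A"
  shows "A = (\<Union>t\<in>head k ` A. cyl p k t)"
proof (rule set_eqI, rule iffI)
  fix x assume x: "x \<in> A"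
  then have "x \<in> cyl p k (head k x)" using assms by (auto simp: digit_det_def cyl_def head_def)
  then show "x \<in> (\<Union>t\<in>head k ` A. cyl p k t)" using x by blast
next
  fix x assume "x \<in> (\<Union>t\<in>head k ` A. cyl p k t)"
  then obtain y where "y \<in> A" "x \<in> cyl p k (head k y)" by blast
  then show "x \<in> A" using assms by (simp add: digit_det_def cyl_def head_def)
qed

lemma disjoint_cyl_head: "disjoint_family_on (cyl p k) (head k ` A)"
  unfolding disjoint_family_on_def cyl_def head_def
  by (auto simp: fun_eq_iff)

lemma cyl_head: "cyl p k (head k x) = cyl p k x"
  by (auto simp: cyl_def head_def)

section \<open>Balls as generators of the sigma-algebra\<close>

lemma space_Haar: "space (Haar p) = Zp p"
  by (auto simp: Haar_def space_PiM Zp_def PiE_def Pi_def space_uniform_count_measure)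

lemma digit_measurable: "(\<lambda>x. x i) \<in> measurable (Haar p) (count_space {..<p})"
  unfolding Haar_def
  using measurable_component_singleton[of i UNIV "\<lambda>_. uniform_count_measure {..<p}"]
  by (simp cong: measurable_cong_sets add: sets_uniform_count_measure_count_space)

lemma digit_eq_sets: "{x \<in> Zp p. x i = a} \<in> sets (Haar p)"
proof (cases "a < p")
  case True
  then have "(\<lambda>x. x i) -` {a} \<inter> space (Haar p) \<in> sets (Haar p)"
    by (intro measurable_sets[OF digit_measurable]) auto
  also have "(\<lambda>x. x i) -` {a} \<inter> space (Haar p) = {x \<in> Zp p. x i = a}"
    by (auto simp: space_Haar)
  finally show ?thesis .
next
  case False
  then have "{x \<in> Zp p. x i = a} = {}" by (auto simp: Zp_def)
  then show ?thesis by (metis sets.empty_sets)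
qed

lemma cyl_sets: "cyl p k t \<in> sets (Haar p)"
proof (induction k)
  case 0
  show ?case using sets.top[of "Haar p"] by (simp add: cyl_def space_Haar)
next
  case (Suc k)
  have "cyl p (Suc k) t = cyl p k t \<inter> {x \<in> Zp p. x k = t k}"
    by (auto simp: cyl_def less_Suc_eq)
  then show ?case using Suc digit_eq_sets[of p k "t k"] by (simp add: sets.Int)
qed

lemma digit_det_sets:
  assumes "digit_det p k A" shows "A \<in> sets (Haar p)"
proof -
  have "finite (head k ` A)" using assms by (intro finite_head_image) (auto simp: digit_det_def)
  then have "(\<Union>t\<in>head k ` A. cyl p k t) \<in> sets (Haar p)"
    by (intro sets.finite_UN cyl_sets) auto
  then show ?thesis using digit_det_eq_UN_cyl[OF assms] by simp
qed

text \<open>The preimage of any set whatsoever is a finite union of balls, so the sigma-algebra of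
  \<open>N\<close> does not matter. This yields measurability of characters, of digit shifts and of
  each filled digit.\<close>

lemma measurable_digit_det:
  assumes det: "\<And>x y. x \<in> Zp p \<Longrightarrow> y \<in> Zp p \<Longrightarrow> (\<And>i. i < k \<Longrightarrow> x i = y i) \<Longrightarrow> f x = f y"
    and "f \<in> Zp p \<rightarrow> space N"
  shows "f \<in> measurable (Haar p) N"
proof (rule measurableI)
  fix A
  have "digit_det p k (f -` A \<inter> space (Haar p))"
    unfolding digit_det_def space_Haar
  proof (intro conjI ballI impI)
    fix x y assume "x \<in> f -` A \<inter> Zp p" "y \<in> Zp p" "\<forall>i<k. x i = y i"
    with det[of x y] show "y \<in> f -` A \<inter> Zp p" by auto
  qed auto
  then show "f -` A \<inter> space (Haar p) \<in> sets (Haar p)" by (rule digit_det_sets)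
qed (use assms(2) in \<open>auto simp: space_Haar\<close>)

lemma sets_Haar: "sets (Haar p) = sigma_sets (Zp p) {A. \<exists>k. digit_det p k A}"
proof (rule antisym)
  have Zp: "(\<Pi>\<^sub>E i\<in>(UNIV::nat set). space (uniform_count_measure {..<p})) = Zp p"
    by (auto simp: Zp_def PiE_def Pi_def space_uniform_count_measure)
  show "sets (Haar p) \<subseteq> sigma_sets (Zp p) {A. \<exists>k. digit_det p k A}"
    unfolding Haar_def sets_PiM_single Zp
  proof (rule sigma_sets_mono)
    show "{{f \<in> Zp p. f i \<in> A} |i A. i \<in> UNIV \<and> A \<in> sets (uniform_count_measure {..<p})}
       \<subseteq> sigma_sets (Zp p) {A. \<exists>k. digit_det p k A}"
    proof clarify
      fix i :: nat and A
      have "digit_det p (Suc i) {f \<in> Zp p. f i \<in> A}"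
        by (auto simp: digit_det_def)
      then show "{f \<in> Zp p. f i \<in> A} \<in> sigma_sets (Zp p) {A. \<exists>k. digit_det p k A}"
        by (intro sigma_sets.Basic) auto
    qed
  qed
  show "sigma_sets (Zp p) {A. \<exists>k. digit_det p k A} \<subseteq> sets (Haar p)"
    unfolding space_Haar[symmetric]
    by (rule sets.sigma_sets_subset) (auto intro: digit_det_sets)
qed

lemma Int_stable_digit_det: "Int_stable {A. \<exists>k. digit_det p k A}"
proof (rule Int_stableI, clarify)
  fix A B k l assume "digit_det p k A" "digit_det p l B"
  then have "digit_det p (max k l) A" "digit_det p (max k l) B"
    by (auto elim: digit_det_mono)
  then show "\<exists>m. digit_det p m (A \<inter> B)"
    unfolding digit_det_def by (intro exI[of _ "max k l"]) auto
qed

lemma digit_det_subset_Pow: "{A. \<exists>k. digit_det p k A} \<subseteq> Pow (Zp p)"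
  by (auto simp: digit_det_def)

lemma digit_det_Zp: "digit_det p k (Zp p)"
  by (auto simp: digit_det_def)

lemma emeasure_digit_det:
  assumes "sets N = sets (Haar p)" "digit_det p k A"
  shows "emeasure N A = (\<Sum>t\<in>head k ` A. emeasure N (cyl p k t))"
proof -
  have "finite (head k ` A)" using assms by (intro finite_head_image) (auto simp: digit_det_def)
  then have "(\<Sum>t\<in>head k ` A. emeasure N (cyl p k t)) = emeasure N (\<Union>t\<in>head k ` A. cyl p k t)"
    using assms(1) by (intro sum_emeasure disjoint_cyl_head) (auto intro: cyl_sets)
  then show ?thesis using digit_det_eq_UN_cyl[OF assms(2)] by simp
qed

text \<open>A set determined by \<open>k\<close> digits is also determined by \<open>max k g\<close>
  digits, hence a finite disjoint union of balls of level at least \<open>g\<close>. The freedom in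
  \<open>g\<close> lets a caller ignore balls too coarse to see the relevant digits.\<close>

lemma measure_eqI_cyl:
  assumes M: "finite_measure M" "sets M = sets (Haar p)" and N: "sets N = sets (Haar p)"
    and eq: "\<And>k t. k \<ge> g \<Longrightarrow> t \<in> Zp p \<Longrightarrow> emeasure M (cyl p k t) = emeasure N (cyl p k t)"
  shows "M = N"
proof (rule measure_eqI_generator_eq[OF Int_stable_digit_det digit_det_subset_Pow])
  fix A assume "A \<in> {A. \<exists>k. digit_det p k A}"
  then obtain k where "digit_det p k A" by auto
  then have A: "digit_det p (max k g) A" by (auto elim: digit_det_mono)
  have "emeasure M (cyl p (max k g) t) = emeasure N (cyl p (max k g) t)"
    if t: "t \<in> head (max k g) ` A" for t
    using t A eq[of "max k g"] by (auto simp: cyl_head digit_det_def)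
  then show "emeasure M A = emeasure N A"
    unfolding emeasure_digit_det[OF M(2) A] emeasure_digit_det[OF N A] by simp
next
  show "sets M = sigma_sets (Zp p) {A. \<exists>k. digit_det p k A}"
    "sets N = sigma_sets (Zp p) {A. \<exists>k. digit_det p k A}"
    using M N sets_Haar by auto
  show "emeasure M (Zp p) \<noteq> \<infinity>" for i :: nat
    using M(1) by (simp add: finite_measure.emeasure_finite)
  show "range (\<lambda>_::nat. Zp p) \<subseteq> {A. \<exists>k. digit_det p k A}" using digit_det_Zp by auto
qed simp

text \<open>Finite unions of balls form a generator closed under intersection, and the sets over
  which \<open>f\<close> integrates to 0 are closed under complement and countable disjoint union.
  Completeness of the characters is reduced to this criterion.\<close>

lemma AE_eq_0_if_cyl_integrals_0:
  fixes f :: "(nat \<Rightarrow> nat) \<Rightarrow> complex"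
  assumes fin: "finite_measure N" and N: "sets N = sets (Haar p)" and f: "integrable N f"
    and cyl0: "\<And>k t. t \<in> Zp p \<Longrightarrow> (\<integral>x\<in>cyl p k t. f x \<partial>N) = 0"
  shows "AE x in N. f x = 0"
proof -
  interpret finite_measure N by (rule fin)
  have space: "space N = Zp p" using sets_eq_imp_space_eq[OF N] space_Haar by simp
  have si: "set_integrable N A f" if "A \<in> sets N" for A
    using f that unfolding set_integrable_def by (simp add: integrable_mult_indicator)
  have det: "(\<integral>x\<in>A. f x \<partial>N) = 0" if A: "digit_det p k A" for k A
  proof -
    have fin: "finite (head k ` A)" using A by (intro finite_head_image) (auto simp: digit_det_def)
    have "(\<integral>x\<in>(\<Union>t\<in>head k ` A. cyl p k t). f x \<partial>N) = (\<Sum>t\<in>head k ` A. (\<integral>x\<in>cyl p k t. f x \<partial>N))"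
      by (intro set_integral_finite_Union fin disjoint_cyl_head si) (auto simp: N cyl_sets)
    also have "\<dots> = 0"
      using A by (intro sum.neutral) (auto simp: cyl_head digit_det_def intro!: cyl0)
    finally show ?thesis using digit_det_eq_UN_cyl[OF A] by simp
  qed
  have "(\<integral>x\<in>A. f x \<partial>N) = 0" if "A \<in> sets N" for A
  proof -
    have "A \<in> sigma_sets (Zp p) {A. \<exists>k. digit_det p k A}" using that N sets_Haar by auto
    with Int_stable_digit_det digit_det_subset_Pow show ?thesis
    proof (induction rule: sigma_sets_induct_disjoint)
      case (basic A) then show ?case using det by auto
    next
      case empty show ?case by (simp add: set_lebesgue_integral_def)
    next
      case (compl A)
      have A: "A \<in> sets N" using compl N sets_Haar by auto
      have Z: "Zp p \<in> sets N" using space by (metis sets.top)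
      have "(\<integral>x\<in>Zp p. f x \<partial>N) = (\<integral>x\<in>A \<union> (Zp p - A). f x \<partial>N)"
        using sets.sets_into_space[OF A] space by (simp add: Un_absorb1)
      also have "\<dots> = (\<integral>x\<in>A. f x \<partial>N) + (\<integral>x\<in>Zp p - A. f x \<partial>N)"
        using A Z by (intro set_integral_Un si) auto
      finally show ?case using det[OF digit_det_Zp] compl by simp
    next
      case (union A)
      have A: "A i \<in> sets N" for i using union N sets_Haar by auto
      have "(\<integral>x\<in>(\<Union>i. A i). f x \<partial>N) = (\<Sum>i. (\<integral>x\<in>A i. f x \<partial>N))"
        using union A by (intro lebesgue_integral_countable_add si) (auto simp: disjoint_family_on_def)
      then show ?case using union by simp
    qed
  qed
  then show ?thesis
    \<comment> \<open>Vanishing of all set integrals is read as equality of the densities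
      \<open>f\<close> and 0.\<close>
    by (intro density_unique_banach[OF f, where f'="\<lambda>_. 0"]) auto
qed

section \<open>Haar measure of sets with prescribed digits\<close>

lemma prob_space_Haar: "p > 0 \<Longrightarrow> prob_space (Haar p)"
  unfolding Haar_def
  by (intro prob_space_PiM prob_space_uniform_count_measure) (auto simp: lessThan_empty_iff)

text \<open>The positions \<open>K\<close> need not be an initial segment: the preimage of a ball
  under the filling map prescribes only digits outside \<open>J\<close>.\<close>

lemma emeasure_Haar_digits:
  assumes p: "p > 0" and K: "finite K" and t: "t \<in> Zp p"
  shows "emeasure (Haar p) {x \<in> Zp p. \<forall>i\<in>K. x i = t i} = ennreal ((1 / real p) ^ card K)"
proof -
  interpret product_prob_space "\<lambda>_::nat. uniform_count_measure {..<p}" UNIV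
    using p by (intro product_prob_spaceI prob_space_uniform_count_measure) (auto simp: lessThan_empty_iff)
  have "emeasure (Haar p) {x \<in> space (Haar p). \<forall>i\<in>K. x i \<in> {t i}}
      = (\<Prod>i\<in>K. emeasure (uniform_count_measure {..<p}) {t i})"
    unfolding Haar_def using K t
    by (intro emeasure_PiM_Collect) (auto simp: sets_uniform_count_measure Zp_def)
  also have "\<dots> = (\<Prod>i\<in>K. ennreal (1 / real p))"
    using t by (intro prod.cong) (auto simp: emeasure_uniform_count_measure Zp_def)
  also have "\<dots> = ennreal ((1 / real p) ^ card K)"
    by (simp only: prod_constant) (simp add: ennreal_power)
  finally show ?thesis by (simp add: space_Haar)
qed

section \<open>Continuous functions on the p-adic integers\<close>

lemma limitin_Zp_top:
  assumes "\<And>g. X g \<in> Zp p" "x \<in> Zp p" "\<And>i g. i < g \<Longrightarrow> X g i = x i"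
  shows "limitin (Zp_top p) X x sequentially"
  unfolding Zp_top_def limitin_componentwise
proof (intro conjI ballI)
  fix i
  show "limitin (discrete_topology {..<p}) (\<lambda>g. X g i) (x i) sequentially"
  proof (rule limitin_eventually)
    show "\<forall>\<^sub>F g in sequentially. X g i = x i"
      using eventually_gt_at_top[of i] by eventually_elim (rule assms(3))
  qed (use assms in \<open>auto simp: Zp_def\<close>)
qed (use assms in \<open>auto simp: Zp_def PiE_def Pi_def\<close>)

lemma continuous_limit:
  assumes "continuous_map (Zp_top p) euclideanreal f"
    and "\<And>g. X g \<in> Zp p" "x \<in> Zp p" "\<And>i g. i < g \<Longrightarrow> X g i = x i"
  shows "(\<lambda>g. f (X g)) \<longlonglongrightarrow> f x"
  using continuous_map_limit[OF assms(1) limitin_Zp_top[OF assms(2-4)]] by (simp add: o_def)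

text \<open>A continuous function is the pointwise limit of the locally constant functions obtained
  by truncating the argument, so no comparison of Borel sets with the product sigma-algebra is
  required.\<close>

lemma continuous_measurable:
  assumes p: "p > 0" and f: "continuous_map (Zp_top p) euclideanreal f"
  shows "f \<in> borel_measurable (Haar p)"
proof (rule borel_measurable_LIMSEQ_real)
  show "(\<lambda>k. f (head k x)) \<longlonglongrightarrow> f x" if "x \<in> space (Haar p)" for x
    using that p by (intro continuous_limit[OF f] head_in_Zp) (auto simp: space_Haar head_def)
  show "(\<lambda>x. f (head k x)) \<in> borel_measurable (Haar p)" for k
    by (rule measurable_digit_det[where k = k]) (auto intro!: arg_cong[where f = f] simp: head_def)
qed

text \<open>The product of finite discrete spaces is compact by Tychonoff. The bound later serves as
  the dominating constant for weak convergence.\<close>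

lemma continuous_bounded:
  assumes f: "continuous_map (Zp_top p) euclideanreal f"
  obtains B where "\<And>x. x \<in> Zp p \<Longrightarrow> norm (f x) \<le> B"
proof -
  have ts: "topspace (Zp_top p) = Zp p" by (auto simp: Zp_top_def Zp_def PiE_def Pi_def)
  have "compact_space (Zp_top p)"
    unfolding Zp_top_def by (simp add: compact_space_product_topology compact_space_discrete_topology)
  then have "compactin euclideanreal (f ` Zp p)"
    using image_compactin[OF _ f] ts by (auto simp: compact_space_def)
  then have "bounded (f ` Zp p)" by (simp add: compact_imp_bounded)
  then show ?thesis using that by (auto simp: bounded_iff)
qed

subsection \<open>Filling in the determined digits\<close>

text \<open>The rule \<open>\<phi>\<close> takes the list of all earlier digits, so the recursion
  carries that list; \<open>fill\<close> below is the map T of the overview.\<close>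

primrec fill_list :: "nat set \<Rightarrow> (nat \<Rightarrow> nat list \<Rightarrow> nat) \<Rightarrow> (nat \<Rightarrow> nat) \<Rightarrow> nat \<Rightarrow> nat list" where
  "fill_list J \<phi> x 0 = []"
| "fill_list J \<phi> x (Suc n) =
    fill_list J \<phi> x n @ [if n \<in> J then \<phi> n (fill_list J \<phi> x n) else x n]"

definition fill :: "nat set \<Rightarrow> (nat \<Rightarrow> nat list \<Rightarrow> nat) \<Rightarrow> (nat \<Rightarrow> nat) \<Rightarrow> nat \<Rightarrow> nat" where
  "fill J \<phi> x n = (if n \<in> J then \<phi> n (fill_list J \<phi> x n) else x n)"

definition admissible :: "nat set \<Rightarrow> (nat \<Rightarrow> nat list \<Rightarrow> nat) \<Rightarrow> nat \<Rightarrow> (nat \<Rightarrow> nat) \<Rightarrow> bool" where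
  "admissible J \<phi> k t \<longleftrightarrow> (\<forall>j\<in>J. j < k \<longrightarrow> t j = \<phi> j (map t [0..<j]))"

lemma fill_list_eq: "fill_list J \<phi> x n = map (fill J \<phi> x) [0..<n]"
  by (induction n) (auto simp: fill_def)

lemma fill_rec: "fill J \<phi> x n = (if n \<in> J then \<phi> n (map (fill J \<phi> x) [0..<n]) else x n)"
  by (simp add: fill_def fill_list_eq)

lemma admissible_fill: "admissible J \<phi> k (fill J \<phi> x)"
  unfolding admissible_def using fill_rec by metis

lemma admissible_cong: "(\<And>i. i < k \<Longrightarrow> s i = t i) \<Longrightarrow> admissible J \<phi> k s \<longleftrightarrow> admissible J \<phi> k t"
proof -
  assume st: "\<And>i. i < k \<Longrightarrow> s i = t i"
  then have *: "map s [0..<j] = map t [0..<j]" if "j < k" for j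
    using that by (intro map_cong) auto
  show ?thesis by (auto simp: admissible_def st *)
qed

text \<open>An admissible sequence is determined by its digits outside \<open>J\<close>, by strong
  induction on the position.\<close>

lemma fill_eqI:
  assumes t: "admissible J \<phi> k t" "\<And>i. i < k \<Longrightarrow> i \<notin> J \<Longrightarrow> x i = t i"
  shows "i < k \<Longrightarrow> fill J \<phi> x i = t i"
proof (induction i rule: less_induct)
  case (less i)
  then have *: "map (fill J \<phi> x) [0..<i] = map t [0..<i]"
    by (intro map_cong) auto
  show ?case using t less.prems fill_rec[of J \<phi> x i, unfolded *] by (auto simp: admissible_def)
qed

lemma fill_eq_iff:
  "(\<forall>i<k. fill J \<phi> x i = t i) \<longleftrightarrow> admissible J \<phi> k t \<and> (\<forall>i<k. i \<notin> J \<longrightarrow> x i = t i)"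
proof
  assume L: "\<forall>i<k. fill J \<phi> x i = t i"
  then have "admissible J \<phi> k t" using admissible_fill admissible_cong by metis
  moreover have "\<forall>i<k. i \<notin> J \<longrightarrow> x i = t i" using L by (auto simp: fill_def)
  ultimately show "admissible J \<phi> k t \<and> (\<forall>i<k. i \<notin> J \<longrightarrow> x i = t i)" ..
qed (use fill_eqI in blast)

text \<open>Filling is causal: \<open>fill J \<phi> x\<close> is itself admissible and can be taken
  as the target in \<open>fill_eqI\<close>.\<close>

lemma fill_cong: "(\<And>i. i < k \<Longrightarrow> x i = y i) \<Longrightarrow> i < k \<Longrightarrow> fill J \<phi> x i = fill J \<phi> y i"
  using fill_eqI[OF admissible_fill, of k J x \<phi> y i] by (auto simp: fill_def)

text \<open>Stopping the filling at \<open>g\<close> is encoded by shrinking the rule set to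
  \<open>J \<inter> {..<g}\<close>, so that partial fillings inherit every result about full
  ones.\<close>

lemma fill_restrict:
  "i < g \<Longrightarrow> fill (J \<inter> {..<g}) \<phi> x i = fill J \<phi> x i"
  "i \<ge> g \<Longrightarrow> fill (J \<inter> {..<g}) \<phi> x i = x i"
proof -
  have "admissible (J \<inter> {..<g}) \<phi> g (fill J \<phi> x)"
    using admissible_fill[of J \<phi> g x] by (auto simp: admissible_def)
  then show "i < g \<Longrightarrow> fill (J \<inter> {..<g}) \<phi> x i = fill J \<phi> x i"
    by (rule fill_eqI) (auto simp: fill_rec)
qed (auto simp: fill_def)

section \<open>The sets \<open>Omega\<close> and the image of Haar measure under filling\<close>

lemma Omega_eq: "Omega p J \<phi> g = {x \<in> Zp p. admissible J \<phi> g x}"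
proof (intro equalityI subsetI)
  fix x assume "x \<in> Omega p J \<phi> g"
  then obtain t where t: "t \<in> C p J \<phi> g" "x \<in> cyl p g t" by (auto simp: Omega_def)
  then have "admissible J \<phi> g t" by (auto simp: C_def admissible_def)
  then have "admissible J \<phi> g x" using t admissible_cong[of g x t] by (auto simp: cyl_def)
  then show "x \<in> {x \<in> Zp p. admissible J \<phi> g x}" using t by (auto simp: cyl_def)
next
  fix x assume x: "x \<in> {x \<in> Zp p. admissible J \<phi> g x}"
  have "admissible J \<phi> g (head g x)"
    using x admissible_cong[of g x "head g x"] by (auto simp: head_def)
  then have "head g x \<in> C p J \<phi> g"
    using x by (auto simp: C_def admissible_def Zp_def head_def)
  moreover have "x \<in> cyl p g (head g x)" using x by (auto simp: cyl_def head_def)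
  ultimately show "x \<in> Omega p J \<phi> g" by (auto simp: Omega_def)
qed

lemma Omega_Suc_subset: "Omega p J \<phi> (Suc g) \<subseteq> Omega p J \<phi> g"
  unfolding Omega_eq admissible_def by auto

lemma digit_det_Omega: "digit_det p g (Omega p J \<phi> g)"
  unfolding digit_det_def Omega_eq using admissible_cong by blast

definition fill_measure :: "nat \<Rightarrow> nat set \<Rightarrow> (nat \<Rightarrow> nat list \<Rightarrow> nat) \<Rightarrow> (nat \<Rightarrow> nat) measure" where
  "fill_measure p J \<phi> = distr (Haar p) (Haar p) (fill J \<phi>)"

lemma sets_fill_measure: "sets (fill_measure p J \<phi>) = sets (Haar p)"
  and space_fill_measure: "space (fill_measure p J \<phi>) = Zp p"
  by (simp_all add: fill_measure_def space_Haar)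

locale digit_rule =
  fixes p :: nat and J :: "nat set" and \<phi> :: "nat \<Rightarrow> nat list \<Rightarrow> nat"
  assumes p: "p > 1"
    and \<phi>: "\<And>j ts. j \<in> J \<Longrightarrow> length ts = j \<Longrightarrow> set ts \<subseteq> {..<p} \<Longrightarrow> \<phi> j ts < p"
begin

lemma fill_in_Zp: assumes "x \<in> Zp p" shows "fill J \<phi> x \<in> Zp p"
proof -
  have "fill J \<phi> x n < p" for n
  proof (induction n rule: less_induct)
    case (less n)
    have "\<phi> n (map (fill J \<phi> x) [0..<n]) < p" if "n \<in> J"
      using that less by (intro \<phi>) auto
    then show ?case using assms fill_rec[of J \<phi> x n] by (auto simp: Zp_def)
  qed
  then show ?thesis by (simp add: Zp_def)
qed

lemma fill_measurable: "fill J \<phi> \<in> measurable (Haar p) (Haar p)"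
proof -
  have "(\<lambda>x n. fill J \<phi> x n) \<in> measurable (Haar p) (PiM UNIV (\<lambda>_. uniform_count_measure {..<p}))"
  proof (rule measurable_PiM_single')
    show "(\<lambda>x. fill J \<phi> x n) \<in> measurable (Haar p) (uniform_count_measure {..<p})" for n
    proof (rule measurable_digit_det[where k = "Suc n"])
      show "(\<lambda>x. fill J \<phi> x n) \<in> Zp p \<rightarrow> space (uniform_count_measure {..<p})"
        using fill_in_Zp by (auto simp: space_uniform_count_measure Zp_def)
    qed (rule fill_cong[where k = "Suc n"], auto)
    show "(\<lambda>x n. fill J \<phi> x n) \<in> space (Haar p) \<rightarrow> (\<Pi>\<^sub>E n\<in>UNIV. space (uniform_count_measure {..<p}))"
      using fill_in_Zp by (auto simp: space_uniform_count_measure Zp_def space_Haar)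
  qed
  then show ?thesis by (simp add: Haar_def)
qed

lemma prob_space_fill_measure: "prob_space (fill_measure p J \<phi>)"
  unfolding fill_measure_def
  using p by (intro prob_space.prob_space_distr prob_space_Haar fill_measurable) auto

lemma vimage_fill_cyl:
  "fill J \<phi> -` cyl p k t \<inter> Zp p =
    (if admissible J \<phi> k t then {x \<in> Zp p. \<forall>i\<in>{..<k} - J. x i = t i} else {})"
proof -
  have "fill J \<phi> x \<in> cyl p k t \<longleftrightarrow> admissible J \<phi> k t \<and> (\<forall>i\<in>{..<k} - J. x i = t i)"
    if "x \<in> Zp p" for x
    using fill_in_Zp[OF that] fill_eq_iff[of k J \<phi> x t] by (auto simp: cyl_def)
  then show ?thesis by auto
qed

lemma emeasure_fill_measure_cyl:
  assumes t: "t \<in> Zp p"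
  shows "emeasure (fill_measure p J \<phi>) (cyl p k t) =
    (if admissible J \<phi> k t then ennreal ((1 / real p) ^ card ({..<k} - J)) else 0)"
  using vimage_fill_cyl[of k t] emeasure_Haar_digits[of p "{..<k} - J" t] t p
  by (simp add: fill_measure_def emeasure_distr fill_measurable cyl_sets space_Haar)

lemma digit_rule_restrict: "digit_rule p (J \<inter> A) \<phi>"
  using p \<phi> by unfold_locales auto

text \<open>On each level-\<open>g\<close> ball of \<open>Omega\<close>, Haar measure is p^(-c)
  times the filled measure, with c the number of determined positions below \<open>g\<close>. Since
  the filled measure gives \<open>Omega\<close> mass 1, summing over the balls avoids counting
  \<open>C\<close>.\<close>

lemma emeasure_Haar_Omega:
  "emeasure (Haar p) (Omega p J \<phi> g) = ennreal ((1 / real p) ^ card (J \<inter> {..<g}))"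
    (is "_ = ennreal ((1 / real p) ^ ?c)")
proof -
  let ?\<Omega> = "Omega p J \<phi> g"
  interpret Haar: prob_space "Haar p" using p by (intro prob_space_Haar) auto
  have \<Omega>: "?\<Omega> \<subseteq> Zp p" "?\<Omega> \<in> sets (Haar p)"
    using digit_det_Omega digit_det_sets by (auto simp: Omega_eq)
  have card: "g = ?c + card ({..<g} - J)"
    by (metis card_Int_Diff card_lessThan finite_lessThan inf_commute)
  have "emeasure (fill_measure p J \<phi>) ?\<Omega> = emeasure (Haar p) (space (Haar p))"
    using \<Omega> admissible_fill fill_in_Zp
    by (auto simp: fill_measure_def emeasure_distr fill_measurable Omega_eq space_Haar
        intro!: arg_cong[where f = "emeasure (Haar p)"])
  then have one: "emeasure (fill_measure p J \<phi>) ?\<Omega> = 1" by (simp add: Haar.emeasure_space_1)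
  have "emeasure (Haar p) (cyl p g t) =
      ennreal ((1 / real p) ^ ?c) * emeasure (fill_measure p J \<phi>) (cyl p g t)"
    if "t \<in> head g ` ?\<Omega>" for t
  proof -
    obtain x where x: "x \<in> Zp p" "admissible J \<phi> g x" "t = head g x"
      using \<open>t \<in> head g ` ?\<Omega>\<close> by (auto simp: Omega_eq)
    have "emeasure (Haar p) (cyl p g x) = ennreal ((1 / real p) ^ g)"
      using emeasure_Haar_digits[of p "{..<g}" x] p x by (simp add: cyl_def Ball_def)
    also have "\<dots> = ennreal ((1 / real p) ^ ?c * (1 / real p) ^ card ({..<g} - J))"
      by (subst card) (simp add: power_add)
    also have "\<dots> = ennreal ((1 / real p) ^ ?c) * emeasure (fill_measure p J \<phi>) (cyl p g x)"
      using x by (simp add: emeasure_fill_measure_cyl ennreal_mult)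
    finally show ?thesis using x by (simp add: cyl_head)
  qed
  then have "emeasure (Haar p) ?\<Omega> = ennreal ((1 / real p) ^ ?c) * emeasure (fill_measure p J \<phi>) ?\<Omega>"
    unfolding emeasure_digit_det[OF refl digit_det_Omega]
      emeasure_digit_det[OF sets_fill_measure digit_det_Omega] sum_distrib_left
    by (intro sum.cong) auto
  then show ?thesis using one by simp
qed

text \<open>On a ball of level \<open>k\<close> at least \<open>g\<close>, both sides vanish unless
  its centre is admissible up to \<open>g\<close>; otherwise both equal p^(-k) divided by the
  measure of \<open>Omega\<close>, the exponent being the number of free positions below
  \<open>k\<close>.\<close>

lemma uniform_measure_Omega:
  "uniform_measure (Haar p) (Omega p J \<phi> g) = fill_measure p (J \<inter> {..<g}) \<phi>"
    (is "?U = ?F")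
proof -
  let ?c = "card (J \<inter> {..<g})"
  interpret Jg: digit_rule p "J \<inter> {..<g}" \<phi> by (rule digit_rule_restrict)
  interpret F: prob_space ?F by (rule Jg.prob_space_fill_measure)
  have \<Omega>: "Omega p J \<phi> g \<in> sets (Haar p)" using digit_det_Omega digit_det_sets by auto
  have "?F = ?U"
  proof (rule measure_eqI_cyl[where g = g])
    fix k t assume k: "k \<ge> g" and t: "t \<in> Zp p"
    have adm: "admissible (J \<inter> {..<g}) \<phi> k t \<longleftrightarrow> admissible J \<phi> g t"
      using k by (auto simp: admissible_def)
    have "J \<inter> {..<g} = {..<k} \<inter> (J \<inter> {..<g})" using k by auto
    then have card: "k = ?c + card ({..<k} - J \<inter> {..<g})"
      by (metis card_Int_Diff card_lessThan finite_lessThan)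
    have "admissible J \<phi> g x \<longleftrightarrow> admissible J \<phi> g t" if "x \<in> cyl p k t" for x
      using that k by (intro admissible_cong) (simp add: cyl_def)
    then have "Omega p J \<phi> g \<inter> cyl p k t = (if admissible J \<phi> g t then cyl p k t else {})"
      by (auto simp: Omega_eq cyl_def)
    moreover have "emeasure (Haar p) (cyl p k t) = ennreal ((1 / real p) ^ k)"
      using emeasure_Haar_digits[of p "{..<k}" t] p t by (simp add: cyl_def Ball_def)
    moreover have "(1 / real p) ^ k / (1 / real p) ^ ?c = (1 / real p) ^ card ({..<k} - J \<inter> {..<g})"
      by (subst (1) card) (use p in \<open>simp add: power_add\<close>)
    ultimately show "emeasure ?F (cyl p k t) = emeasure ?U (cyl p k t)"
      using p t by (simp add: Jg.emeasure_fill_measure_cyl adm \<Omega> cyl_sets emeasure_Haar_Omega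
          divide_ennreal)
  qed (auto simp: sets_fill_measure)
  then show ?thesis by simp
qed

section \<open>Weak convergence and singularity\<close>

lemma weak_conv_fill_measure:
  "weak_conv_Zp p (\<lambda>g. uniform_measure (Haar p) (Omega p J \<phi> g)) (fill_measure p J \<phi>)"
  unfolding weak_conv_Zp_def uniform_measure_Omega
proof (intro allI impI)
  fix f assume f: "continuous_map (Zp_top p) euclideanreal f"
  obtain B where B: "\<And>x. x \<in> Zp p \<Longrightarrow> norm (f x) \<le> B" using continuous_bounded[OF f] by blast
  interpret Haar: prob_space "Haar p" using p by (intro prob_space_Haar) auto
  have Jg: "digit_rule p (J \<inter> {..<g}) \<phi>" for g by (rule digit_rule_restrict)
  have meas: "f \<in> borel_measurable (Haar p)" using p f by (intro continuous_measurable) auto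
  \<comment> \<open>Pulling back along the fillings turns integrals against varying measures into
    integrals of varying functions against the single Haar measure.\<close>
  have "(\<lambda>g. \<integral>x. f (fill (J \<inter> {..<g}) \<phi> x) \<partial>Haar p) \<longlonglongrightarrow> (\<integral>x. f (fill J \<phi> x) \<partial>Haar p)"
  proof (rule integral_dominated_convergence[where w = "\<lambda>_. B"])
    show "(\<lambda>x. f (fill J \<phi> x)) \<in> borel_measurable (Haar p)"
      using measurable_compose[OF fill_measurable meas] .
    show "(\<lambda>x. f (fill (J \<inter> {..<g}) \<phi> x)) \<in> borel_measurable (Haar p)" for g
      using measurable_compose[OF digit_rule.fill_measurable[OF Jg] meas] .
    show "AE x in Haar p. (\<lambda>g. f (fill (J \<inter> {..<g}) \<phi> x)) \<longlonglongrightarrow> f (fill J \<phi> x)"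
    proof (rule AE_I2)
      fix x assume "x \<in> space (Haar p)"
      then show "(\<lambda>g. f (fill (J \<inter> {..<g}) \<phi> x)) \<longlonglongrightarrow> f (fill J \<phi> x)"
        by (intro continuous_limit[OF f] digit_rule.fill_in_Zp[OF Jg] fill_in_Zp fill_restrict)
          (auto simp: space_Haar)
    qed
    show "AE x in Haar p. norm (f (fill (J \<inter> {..<g}) \<phi> x)) \<le> B" for g
      by (intro AE_I2 B digit_rule.fill_in_Zp[OF Jg]) (simp add: space_Haar)
  qed simp
  then show "(\<lambda>g. \<integral>x. f x \<partial>fill_measure p (J \<inter> {..<g}) \<phi>) \<longlonglongrightarrow> (\<integral>x. f x \<partial>fill_measure p J \<phi>)"
    unfolding fill_measure_def
    by (simp add: integral_distr fill_measurable digit_rule.fill_measurable[OF Jg] meas)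
qed

lemma singular_fill_measure:
  assumes "infinite J"
  shows "singular (fill_measure p J \<phi>) (Haar p)"
  unfolding singular_def
proof (intro bexI conjI)
  let ?A = "\<Inter>g. Omega p J \<phi> g"
  have \<Omega>: "Omega p J \<phi> g \<in> sets (Haar p)" for g using digit_det_Omega digit_det_sets by blast
  then show A: "?A \<in> sets (Haar p)" by (intro sets.countable_INT) auto
  have "emeasure (Haar p) ?A \<le> ennreal ((1 / real p) ^ n)" for n
  proof -
    obtain K where K: "K \<subseteq> J" "finite K" "card K = n"
      using infinite_arbitrarily_large[OF assms] by blast
    then have "K \<subseteq> J \<inter> {..<Suc (Max K)}" by (auto simp: less_Suc_eq_le)
    then have "n \<le> card (J \<inter> {..<Suc (Max K)})" using K by (metis card_mono finite_Int finite_lessThan)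
    then have "(1 / real p) ^ card (J \<inter> {..<Suc (Max K)}) \<le> (1 / real p) ^ n"
      using p by (intro power_decreasing) auto
    moreover have "emeasure (Haar p) ?A \<le> emeasure (Haar p) (Omega p J \<phi> (Suc (Max K)))"
      using \<Omega> by (intro emeasure_mono) auto
    ultimately show ?thesis unfolding emeasure_Haar_Omega by (meson ennreal_leI order_trans)
  qed
  moreover have "(\<lambda>n. ennreal ((1 / real p) ^ n)) \<longlonglongrightarrow> ennreal 0"
    using p by (intro tendsto_ennrealI LIMSEQ_power_zero) auto
  ultimately have "emeasure (Haar p) ?A \<le> ennreal 0"
    by (intro LIMSEQ_le_const) auto
  then show "emeasure (Haar p) ?A = 0" by simp
  \<comment> \<open>Every filled sequence is admissible at all levels, so the image of filling lies
    in the Haar-null set \<open>?A\<close>.\<close>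
  have "fill J \<phi> -` (Zp p - ?A) \<inter> space (Haar p) = {}"
    using admissible_fill fill_in_Zp by (auto simp: Omega_eq space_Haar)
  moreover have "Zp p - ?A \<in> sets (Haar p)" using A sets.compl_sets[of ?A "Haar p"] by (simp add: space_Haar)
  ultimately show "emeasure (fill_measure p J \<phi>) (space (fill_measure p J \<phi>) - ?A) = 0"
    unfolding space_fill_measure
    by (simp add: fill_measure_def emeasure_distr fill_measurable)
qed

end

subsection \<open>Characters\<close>

text \<open>This is the character with frequency p^(-i-1); the fractional part is omitted because
  \<open>cis\<close> ignores full turns.\<close>

definition pchar :: "nat \<Rightarrow> nat \<Rightarrow> (nat \<Rightarrow> nat) \<Rightarrow> complex" where
  "pchar p i x = cis (2 * pi * (real (trunc p x (Suc i)) / real p ^ Suc i))"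

lemma norm_pchar: "norm (pchar p i x) = 1"
  by (simp add: pchar_def)

lemma cis_frac: "cis (2 * pi * frac s) = cis (2 * pi * s)"
proof -
  have "2 * pi * s = 2 * pi * frac s + 2 * pi * of_int \<lfloor>s\<rfloor>"
    by (simp add: frac_def algebra_simps)
  then have "cis (2 * pi * s) = cis (2 * pi * frac s) * cis (2 * pi * of_int \<lfloor>s\<rfloor>)"
    by (simp only: cis_mult)
  then show ?thesis by simp
qed

lemma cis_sum: "cis (\<Sum>i\<in>A. f i) = (\<Prod>i\<in>A. cis (f i))"
  by (induction A rule: infinite_finite_induct) (simp_all add: cis_mult[symmetric])

text \<open>Once the fractional part is discarded, the phase is additive in the frequency and the
  character factors. Any bound \<open>g\<close> on the support works, so two characters can share
  one index range.\<close>

lemma chi_eq_prod: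
  assumes b: "\<And>i. i \<ge> g \<Longrightarrow> b i = 0"
  shows "chi p b x = (\<Prod>i<g. pchar p i x ^ b i)"
proof -
  have "{i. b i \<noteq> 0} \<subseteq> {..<g}" using b by (metis (mono_tags) lessThan_iff linorder_not_le mem_Collect_eq subsetI)
  then have "(\<Sum>i\<in>{i. b i \<noteq> 0}. real (b i) * real (trunc p x (Suc i)) / real p ^ Suc i)
    = (\<Sum>i<g. real (b i) * real (trunc p x (Suc i)) / real p ^ Suc i)"
    by (intro sum.mono_neutral_left) auto
  then have "chi p b x = cis (2 * pi * (\<Sum>i<g. real (b i) * real (trunc p x (Suc i)) / real p ^ Suc i))"
    unfolding chi_def padic_frac_prod_def cis_frac by simp
  also have "\<dots> = (\<Prod>i<g. cis (2 * pi * (real (b i) * real (trunc p x (Suc i)) / real p ^ Suc i)))"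
    by (simp only: sum_distrib_left cis_sum)
  also have "\<dots> = (\<Prod>i<g. pchar p i x ^ b i)"
    unfolding pchar_def Complex.DeMoivre by (intro prod.cong refl arg_cong[where f = cis]) (simp add: algebra_simps)
  finally show ?thesis .
qed

lemma norm_chi: "norm (chi p b x) = 1"
  by (simp add: chi_def)

lemma pchar_cong: "(\<And>j. j \<le> i \<Longrightarrow> x j = y j) \<Longrightarrow> pchar p i x = pchar p i y"
  unfolding pchar_def trunc_def
  by (intro arg_cong[where f = "\<lambda>n. cis (2 * pi * (real n / real p ^ Suc i))"] sum.cong) auto

text \<open>The digit at \<open>i\<close> contributes x_i p^i / p^(i+1) = x_i / p to the phase. It
  thus enters only as a power of a primitive p-th root of unity, separately from the lower
  digits.\<close>

lemma pchar_split:
  assumes "p > 0"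
  shows "pchar p i x = cis (2 * pi * (real (trunc p x i) / real p ^ Suc i)) * cis (2 * pi / real p) ^ x i"
proof -
  have "real (trunc p x (Suc i)) / real p ^ Suc i = real (trunc p x i) / real p ^ Suc i + real (x i) / real p"
    using assms by (simp add: trunc_def field_simps)
  then have "2 * pi * (real (trunc p x (Suc i)) / real p ^ Suc i)
      = 2 * pi * (real (trunc p x i) / real p ^ Suc i) + real (x i) * (2 * pi / real p)"
    by (simp add: algebra_simps)
  then show ?thesis unfolding pchar_def Complex.DeMoivre by (simp add: cis_mult)
qed

lemma cis_power_inj:
  assumes "m < p" "n < p" "cis (2 * pi / real p) ^ m * cnj (cis (2 * pi / real p) ^ n) = 1"
  shows "m = n"
proof -
  let ?w = "cis (2 * pi / real p)"
  have n1: "cnj (?w ^ n) * ?w ^ n = 1"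
    using complex_norm_square[of "?w ^ n"] by (simp add: norm_power mult.commute)
  have "?w ^ m = ?w ^ m * (cnj (?w ^ n) * ?w ^ n)" unfolding n1 by simp
  also have "\<dots> = ?w ^ n" using assms(3) by (metis mult.assoc mult_1)
  finally have "cis (2 * pi * real m / real p) = cis (2 * pi * real n / real p)"
    by (simp add: Complex.DeMoivre algebra_simps)
  moreover have "inj_on (\<lambda>k. cis (2 * pi * real k / real p)) {..<p}"
    using Complex.bij_betw_roots_unity[of p] assms(1) by (auto simp: bij_betw_def)
  ultimately show ?thesis using assms by (auto simp: inj_on_def)
qed

text \<open>There is no carry, so this is not translation by p^i: all other digits stay
  fixed.\<close>

definition shift_digit :: "nat \<Rightarrow> nat \<Rightarrow> (nat \<Rightarrow> nat) \<Rightarrow> nat \<Rightarrow> nat" where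
  "shift_digit p i x = x(i := Suc (x i) mod p)"

lemma shift_digit_in_Zp: "x \<in> Zp p \<Longrightarrow> shift_digit p i x \<in> Zp p"
  by (auto simp: shift_digit_def Zp_def intro!: mod_less_divisor)

lemma shift_digit_measurable: "shift_digit p i \<in> measurable (Haar p) (Haar p)"
proof -
  have "(\<lambda>x n. shift_digit p i x n) \<in> measurable (Haar p) (PiM UNIV (\<lambda>_. uniform_count_measure {..<p}))"
  proof (rule measurable_PiM_single')
    show "(\<lambda>x. shift_digit p i x n) \<in> measurable (Haar p) (uniform_count_measure {..<p})" for n
    proof (rule measurable_digit_det[where k = "Suc (max i n)"])
      show "(\<lambda>x. shift_digit p i x n) \<in> Zp p \<rightarrow> space (uniform_count_measure {..<p})"
        using shift_digit_in_Zp by (auto simp: space_uniform_count_measure Zp_def)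
    qed (auto simp: shift_digit_def)
    show "(\<lambda>x n. shift_digit p i x n) \<in> space (Haar p) \<rightarrow> (\<Pi>\<^sub>E n\<in>UNIV. space (uniform_count_measure {..<p}))"
      using shift_digit_in_Zp by (auto simp: space_uniform_count_measure Zp_def space_Haar)
  qed
  then show ?thesis by (simp add: Haar_def)
qed

lemma distr_shift_digit:
  assumes p: "p > 0"
  shows "distr (Haar p) (Haar p) (shift_digit p i) = Haar p"
proof (rule measure_eqI_cyl[where g = "Suc i" and p = p])
  interpret Haar: prob_space "Haar p" using p by (rule prob_space_Haar)
  show "finite_measure (distr (Haar p) (Haar p) (shift_digit p i))"
    by (intro Haar.finite_measure_distr shift_digit_measurable)
  fix k t assume k: "Suc i \<le> k" and t: "t \<in> Zp p"
  \<comment> \<open>The digit of \<open>s\<close> at \<open>i\<close> is the cyclic predecessor of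
    \<open>t i\<close>, making the ball around \<open>s\<close> the preimage of the ball around
    \<open>t\<close>.\<close>
  define s where "s = t(i := if t i = 0 then p - 1 else t i - 1)"
  have s: "s \<in> Zp p" using t p by (auto simp: s_def Zp_def less_imp_diff_less)
  have digit: "Suc a mod p = t i \<longleftrightarrow> a = s i" if "a < p" for a
    using that t by (cases "Suc a = p") (auto simp: s_def Zp_def)
  have "shift_digit p i x \<in> cyl p k t \<longleftrightarrow> x \<in> cyl p k s" if x: "x \<in> Zp p" for x
  proof -
    have "shift_digit p i x j = t j \<longleftrightarrow> x j = s j" for j
      using digit[of "x i"] x by (cases "j = i") (auto simp: shift_digit_def s_def Zp_def)
    then show ?thesis using x shift_digit_in_Zp by (simp add: cyl_def)
  qed
  then have "shift_digit p i -` cyl p k t \<inter> space (Haar p) = cyl p k s"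
    by (auto simp: space_Haar cyl_def)
  then have "emeasure (distr (Haar p) (Haar p) (shift_digit p i)) (cyl p k t) = emeasure (Haar p) (cyl p k s)"
    by (simp add: emeasure_distr shift_digit_measurable cyl_sets)
  also have "\<dots> = emeasure (Haar p) (cyl p k t)"
    using emeasure_Haar_digits[of p "{..<k}" s] emeasure_Haar_digits[of p "{..<k}" t] p s t
    by (simp add: cyl_def Ball_def)
  finally show "emeasure (distr (Haar p) (Haar p) (shift_digit p i)) (cyl p k t) = emeasure (Haar p) (cyl p k t)" .
qed auto

lemma borel_measurable_cnj [measurable (raw)]:
  "f \<in> borel_measurable M \<Longrightarrow> (\<lambda>x. cnj (f x)) \<in> borel_measurable M"
  by (rule borel_measurable_continuous_on[of cnj]) (auto intro: continuous_on_cnj continuous_on_id)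

lemma Lam_bound:
  assumes "b \<in> Lam p I" obtains g where "\<And>i. i \<ge> g \<Longrightarrow> b i = 0"
proof -
  have "finite {i. b i \<noteq> 0}" using assms by (simp add: Lam_def)
  then obtain g where "\<forall>i\<in>{i. b i \<noteq> 0}. i < g" using finite_nat_set_iff_bounded by blast
  then show ?thesis using that[of g] by (metis (mono_tags) leD mem_Collect_eq)
qed

lemma chi_cong:
  assumes b: "\<And>i. i \<ge> g \<Longrightarrow> b i = 0" and "\<And>i. i < g \<Longrightarrow> x i = y i"
  shows "chi p b x = chi p b y"
  unfolding chi_eq_prod[of g b, OF b, simplified]
  using assms(2) by (intro prod.cong refl arg_cong2[where f = power] pchar_cong) auto

lemma chi_measurable:
  assumes "b \<in> Lam p I" shows "chi p b \<in> borel_measurable (Haar p)"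
proof -
  obtain g where g: "\<And>i. i \<ge> g \<Longrightarrow> b i = 0" using Lam_bound[OF assms] by blast
  show ?thesis by (rule measurable_digit_det[where k = g]) (auto intro: chi_cong[of g b, OF g])
qed

section \<open>Orthogonality of the characters\<close>

context digit_rule
begin

lemma fill_chi_measurable:
  "b \<in> Lam p I \<Longrightarrow> chi p b \<in> borel_measurable (fill_measure p J \<phi>)"
  using chi_measurable by (simp add: fill_measure_def)

text \<open>Changing the digit at \<open>i\<close> may alter the filled digits after
  \<open>i\<close> unpredictably. Choosing \<open>i\<close> as the last position where the
  frequencies differ makes this harmless: at later positions the exponents agree and the factors of
  the two characters cancel.\<close>

lemma chi_orthogonal:
  assumes b: "b \<in> Lam p (- J)" and b': "b' \<in> Lam p (- J)" and neq: "b \<noteq> b'"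
  shows "(\<integral>x. chi p b x * cnj (chi p b' x) \<partial>fill_measure p J \<phi>) = 0"
proof -
  let ?w = "cis (2 * pi / real p)"
  define F where "F x = chi p b x * cnj (chi p b' x)" for x
  obtain g1 where g1: "\<And>i. i \<ge> g1 \<Longrightarrow> b i = 0" using Lam_bound[OF b] by blast
  obtain g2 where g2: "\<And>i. i \<ge> g2 \<Longrightarrow> b' i = 0" using Lam_bound[OF b'] by blast
  define g where "g = max g1 g2"
  define G where "G j x = pchar p j x ^ b j * cnj (pchar p j x ^ b' j)" for j x
  have F: "F x = (\<Prod>j<g. G j x)" for x
    using chi_eq_prod[of g b p x] chi_eq_prod[of g b' p x] g1 g2
    by (simp add: F_def G_def g_def prod.distrib)
  define D where "D = {i. b i \<noteq> b' i}"
  have "D \<subseteq> {..<g}"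
  proof
    fix j assume "j \<in> D"
    then have "\<not> (g1 \<le> j \<and> g2 \<le> j)" using g1[of j] g2[of j] by (auto simp: D_def)
    then show "j \<in> {..<g}" by (auto simp: g_def)
  qed
  then have "finite D" "D \<noteq> {}" using neq by (auto simp: D_def finite_subset)
  define i where "i = Max D"
  have i: "i \<in> D" using Max_in \<open>finite D\<close> \<open>D \<noteq> {}\<close> by (simp add: i_def)
  have ig: "i < g" using i \<open>D \<subseteq> {..<g}\<close> by auto
  \<comment> \<open>Both frequencies vanish on \<open>J\<close>, so a position where they differ is
    free and filling preserves the shift there.\<close>
  have iJ: "i \<notin> J" using i b b' by (auto simp: D_def Lam_def)
  have after: "b j = b' j" if "j > i" for j
    using that Max_ge[OF \<open>finite D\<close>, of j] by (auto simp: i_def D_def)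
  define \<zeta> where "\<zeta> = ?w ^ b i * cnj (?w ^ b' i)"
  have \<zeta>: "\<zeta> \<noteq> 1"
    using cis_power_inj[of "b i" p "b' i"] b b' i by (auto simp: \<zeta>_def Lam_def D_def)
  have wp: "?w ^ p = 1" using p by (simp add: Complex.DeMoivre)
  have shift: "F (fill J \<phi> (shift_digit p i x)) = \<zeta> * F (fill J \<phi> x)" if x: "x \<in> Zp p" for x
  proof -
    let ?y = "fill J \<phi> x" and ?z = "fill J \<phi> (shift_digit p i x)"
    have below: "?z j = ?y j" if "j < i" for j
      using that by (intro fill_cong[of i]) (auto simp: shift_digit_def)
    have at: "?z i = Suc (?y i) mod p" using iJ by (simp add: fill_rec shift_digit_def)
    \<comment> \<open>Wrap-around from p - 1 to 0 is invisible to a p-th root of unity.\<close>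
    have "?w ^ (Suc (?y i) mod p) = ?w ^ Suc (?y i)"
      by (metis wp div_mult_mod_eq mult.commute mult_1 power_add power_mult power_one)
    then have "?w ^ ?z i = ?w * ?w ^ ?y i" unfolding at by simp
    moreover have "trunc p ?z i = trunc p ?y i" using below by (simp add: trunc_def)
    ultimately have "pchar p i ?z = ?w * pchar p i ?y"
      using p by (simp add: pchar_split)
    then have Gi: "G i ?z = \<zeta> * G i ?y"
      by (simp add: G_def \<zeta>_def power_mult_distrib)
    have G: "G j ?z = (if j = i then \<zeta> else 1) * G j ?y" for j
    proof (cases j i rule: linorder_cases)
      case less
      then have "pchar p j ?z = pchar p j ?y" using below by (intro pchar_cong) auto
      then show ?thesis using less by (simp add: G_def)
    next
      case equal
      then show ?thesis using Gi by simp
    next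
      case greater
      have "u ^ n * cnj (u ^ n) = 1" if "norm u = 1" for u :: complex and n
        using complex_norm_square[of "u ^ n"] that by (simp add: norm_power)
      then show ?thesis using greater after[of j] by (simp add: G_def norm_pchar del: complex_cnj_power)
    qed
    show ?thesis
      unfolding F G prod.distrib using ig by simp
  qed
  have Fm: "F \<in> borel_measurable (Haar p)"
    unfolding F_def using chi_measurable[OF b] chi_measurable[OF b'] by measurable
  have Ffm: "(\<lambda>x. F (fill J \<phi> x)) \<in> borel_measurable (Haar p)"
    using measurable_compose[OF fill_measurable Fm] .
  \<comment> \<open>Shift invariance of Haar measure shows that the integral equals
    \<open>\<zeta>\<close> times itself, with \<open>\<zeta>\<close> different from 1.\<close>
  have "(\<integral>x. F (fill J \<phi> x) \<partial>Haar p) = (\<integral>x. F (fill J \<phi> x) \<partial>distr (Haar p) (Haar p) (shift_digit p i))"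
    using p by (simp add: distr_shift_digit)
  also have "\<dots> = (\<integral>x. F (fill J \<phi> (shift_digit p i x)) \<partial>Haar p)"
    by (intro integral_distr shift_digit_measurable Ffm)
  also have "\<dots> = (\<integral>x. \<zeta> * F (fill J \<phi> x) \<partial>Haar p)"
    by (intro Bochner_Integration.integral_cong refl shift) (simp add: space_Haar)
  also have "\<dots> = \<zeta> * (\<integral>x. F (fill J \<phi> x) \<partial>Haar p)" by simp
  finally have "(\<integral>x. F (fill J \<phi> x) \<partial>Haar p) = 0" using \<zeta> by simp
  then have "(\<integral>x. F x \<partial>fill_measure p J \<phi>) = 0"
    by (simp add: fill_measure_def integral_distr fill_measurable Fm)
  then show ?thesis by (simp add: F_def)
qed

lemma chi_norm_integral: "(\<integral>x. chi p b x * cnj (chi p b x) \<partial>fill_measure p J \<phi>) = 1"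
proof -
  interpret prob_space "fill_measure p J \<phi>" by (rule prob_space_fill_measure)
  have "chi p b x * cnj (chi p b x) = 1" for x
    using complex_norm_square[of "chi p b x"] norm_chi[of p b x] by simp
  then show ?thesis by (simp add: prob_space)
qed

section \<open>Completeness of the characters\<close>

text \<open>Elements of \<open>freqs g\<close> are \<open>undefined\<close> from \<open>g\<close> on; \<open>head g\<close> turns them into elements of \<open>Lam\<close>.\<close>

definition freqs :: "nat \<Rightarrow> (nat \<Rightarrow> nat) set" where
  "freqs g = (\<Pi>\<^sub>E i\<in>{..<g}. if i \<in> J then {0} else {..<p})"

lemma finite_freqs: "finite (freqs g)"
  unfolding freqs_def by (intro finite_PiE) auto

lemma freqs_nonempty: "freqs g \<noteq> {}"
  using p by (auto simp: freqs_def PiE_eq_empty_iff)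

lemma head_freqs: "h \<in> freqs g \<Longrightarrow> head g h \<in> Lam p (- J)"
proof -
  assume h: "h \<in> freqs g"
  have "h i < p \<and> (i \<in> J \<longrightarrow> h i = 0)" if "i < g" for i
    using h p that PiE_mem[of h "{..<g}" "\<lambda>i. if i \<in> J then {0} else {..<p}" i]
    by (auto simp: freqs_def split: if_splits)
  then have "\<forall>i. head g h i < p" "\<forall>i. i \<notin> - J \<longrightarrow> head g h i = 0"
    using p by (auto simp: head_def)
  moreover have "finite {i. head g h i \<noteq> 0}"
    by (rule finite_subset[of _ "{..<g}"]) (auto simp: head_def)
  ultimately show ?thesis by (simp add: Lam_def)
qed

text \<open>On admissible points the character sum is a multiple of the indicator of lying in the
  same level-\<open>g\<close> ball. Dually to orthogonality, the decisive position is now the first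
  one where the points differ, since there the lower digits agree and cancel from the phase.\<close>

lemma chi_reproducing:
  assumes x: "x \<in> Zp p" "admissible J \<phi> g x" and y: "y \<in> Zp p" "admissible J \<phi> g y"
  shows "(\<Sum>h\<in>freqs g. chi p (head g h) x * cnj (chi p (head g h) y)) =
    (if \<forall>i<g. x i = y i then of_nat (card (freqs g)) else 0)"
proof (cases "\<forall>i<g. x i = y i")
  case True
  have "chi p (head g h) x * cnj (chi p (head g h) y) = 1" for h
  proof -
    have "chi p (head g h) x = chi p (head g h) y"
      using True by (intro chi_cong[of g]) (auto simp: head_def)
    then show ?thesis using complex_norm_square[of "chi p (head g h) y"] norm_chi[of p "head g h" y] by simp
  qed
  then show ?thesis using True by simp
next
  case False
  let ?w = "cis (2 * pi / real p)"
  define u where "u i = pchar p i x * cnj (pchar p i y)" for i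
  have chi: "chi p (head g h) z = (\<Prod>i<g. pchar p i z ^ h i)" for h z
    by (subst chi_eq_prod[of g]) (auto simp: head_def intro!: prod.cong)
  have "(\<Sum>h\<in>freqs g. chi p (head g h) x * cnj (chi p (head g h) y)) = (\<Sum>h\<in>freqs g. \<Prod>i<g. u i ^ h i)"
    by (simp add: chi u_def prod.distrib power_mult_distrib)
  \<comment> \<open>Each coefficient ranges independently, so the sum over frequencies factors;
    positions in \<open>J\<close> contribute only the exponent 0.\<close>
  also have "\<dots> = (\<Prod>i<g. \<Sum>c\<in>(if i \<in> J then {0} else {..<p}). u i ^ c)"
    unfolding freqs_def by (intro prod_sum_PiE[symmetric]) auto
  also have "\<dots> = 0"
  proof -
    define i where "i = (LEAST i. i < g \<and> x i \<noteq> y i)"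
    have "i < g \<and> x i \<noteq> y i" unfolding i_def by (rule LeastI_ex) (use False in auto)
    then have i: "i < g" "x i \<noteq> y i" by auto
    have below: "x j = y j" if "j < i" for j
      using that not_less_Least[of j "\<lambda>i. i < g \<and> x i \<noteq> y i"] i(1) by (auto simp: i_def[symmetric])
    \<comment> \<open>At a position in \<open>J\<close>, equal earlier digits would force equal
      digits; hence \<open>i\<close> is free and its geometric sum runs over a full period.\<close>
    have iJ: "i \<notin> J"
    proof
      assume "i \<in> J"
      then have "x i = \<phi> i (map x [0..<i])" "y i = \<phi> i (map y [0..<i])"
        using x y i by (auto simp: admissible_def)
      moreover have "map x [0..<i] = map y [0..<i]" using below by (intro map_cong) auto
      ultimately show False using i by metis
    qed
    have "trunc p x i = trunc p y i" using below by (simp add: trunc_def)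
    then have u: "u i = ?w ^ x i * cnj (?w ^ y i)"
      using p by (simp add: u_def pchar_split cis_cnj cis_mult mult_ac)
    have "u i \<noteq> 1"
      using cis_power_inj[of "x i" p "y i"] x y i by (auto simp: u Zp_def)
    moreover have "?w ^ p = 1" using p by (simp add: Complex.DeMoivre)
    then have "u i ^ p = 1"
      unfolding u power_mult_distrib complex_cnj_power[symmetric] power_mult[symmetric]
      by (simp add: mult.commute[of _ p] power_mult)
    ultimately have "(\<Sum>c<p. u i ^ c) = 0" by (simp add: geometric_sum)
    then show ?thesis using i iJ by (intro prod_zero) auto
  qed
  finally show ?thesis using False by (simp only: if_False)
qed

lemma AE_admissible: "AE x in fill_measure p J \<phi>. admissible J \<phi> g x"
proof -
  have "{x \<in> space (Haar p). admissible J \<phi> g x} \<in> sets (Haar p)"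
    using digit_det_sets[OF digit_det_Omega[of p g J \<phi>]] by (simp add: Omega_eq space_Haar)
  then show ?thesis
    unfolding fill_measure_def by (subst AE_distr_iff[OF fill_measurable]) (auto simp: admissible_fill)
qed

lemma chi_complete:
  fixes f :: "(nat \<Rightarrow> nat) \<Rightarrow> complex"
  assumes f: "f \<in> borel_measurable (fill_measure p J \<phi>)"
    and f2: "integrable (fill_measure p J \<phi>) (\<lambda>x. (cmod (f x))\<^sup>2)"
    and orth: "\<And>b. b \<in> Lam p (- J) \<Longrightarrow> (\<integral>x. f x * cnj (chi p b x) \<partial>fill_measure p J \<phi>) = 0"
  shows "AE x in fill_measure p J \<phi>. f x = 0"
proof -
  let ?\<mu> = "fill_measure p J \<phi>"
  interpret prob_space ?\<mu> by (rule prob_space_fill_measure)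
  \<comment> \<open>On a probability space, square integrability implies integrability.\<close>
  have "integrable ?\<mu> (\<lambda>x. cmod (f x))"
    by (rule square_integrable_imp_integrable[OF measurable_compose[OF f borel_measurable_norm] f2])
  then have int: "integrable ?\<mu> f" using f by (simp add: integrable_norm_iff)
  have intc: "integrable ?\<mu> (\<lambda>x. f x * cnj (chi p b x))" if b: "b \<in> Lam p (- J)" for b
  proof (rule Bochner_Integration.integrable_bound[OF int])
    show "(\<lambda>x. f x * cnj (chi p b x)) \<in> borel_measurable ?\<mu>"
      using f fill_chi_measurable[OF b] by measurable
  qed (simp add: norm_mult norm_chi)
  show ?thesis
  proof (rule AE_eq_0_if_cyl_integrals_0[OF finite_measure_axioms sets_fill_measure int])
    fix k t assume t: "t \<in> Zp p"
    let ?A = "cyl p k t"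
    have A: "?A \<in> sets ?\<mu>" by (simp add: sets_fill_measure cyl_sets)
    show "(\<integral>x\<in>?A. f x \<partial>?\<mu>) = 0"
    proof (cases "admissible J \<phi> k t")
      case False
      \<comment> \<open>A ball with inadmissible centre contains no admissible point and is
        therefore null.\<close>
      have "AE x in ?\<mu>. indicator ?A x *\<^sub>R f x = 0"
        using AE_admissible[of k]
      proof eventually_elim
        case (elim x)
        then have "x \<notin> ?A" using False admissible_cong[of k x t] by (auto simp: cyl_def)
        then show ?case by simp
      qed
      then show ?thesis unfolding set_lebesgue_integral_def by (rule integral_eq_zero_AE)
    next
      case True
      let ?N = "of_nat (card (freqs k)) :: complex"
      \<comment> \<open>This is \<open>f\<close> times the reproducing kernel centred at
        \<open>t\<close>: almost everywhere it equals \<open>?N\<close> times \<open>f\<close>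
        restricted to the ball, and its integral is a combination of the vanishing coefficients of
        \<open>f\<close>.\<close>
      let ?S = "\<lambda>x. \<Sum>h\<in>freqs k. chi p (head k h) t * (f x * cnj (chi p (head k h) x))"
      have N: "?N \<noteq> 0" using finite_freqs freqs_nonempty by simp
      have S_int: "integrable ?\<mu> (\<lambda>x. chi p (head k h) t * (f x * cnj (chi p (head k h) x)))"
        if "h \<in> freqs k" for h
        using intc[OF head_freqs[OF that]] by simp
      have "AE x in ?\<mu>. ?N * (indicator ?A x *\<^sub>R f x) = ?S x"
        using AE_admissible[of k] AE_space
      proof eventually_elim
        case (elim x)
        then have x: "x \<in> Zp p" by (simp add: space_fill_measure)
        have "?S x = f x * (\<Sum>h\<in>freqs k. chi p (head k h) t * cnj (chi p (head k h) x))"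
          by (simp add: sum_distrib_left mult_ac)
        also have "\<dots> = f x * (if \<forall>i<k. t i = x i then ?N else 0)"
          by (subst chi_reproducing[OF t True x elim(1)]) simp
        also have "(\<forall>i<k. t i = x i) \<longleftrightarrow> x \<in> ?A" using x by (auto simp: cyl_def)
        finally show ?case by (simp add: indicator_def)
      qed
      then have "(\<integral>x. ?N * (indicator ?A x *\<^sub>R f x) \<partial>?\<mu>) = (\<integral>x. ?S x \<partial>?\<mu>)"
        using A f S_int
        by (intro integral_cong_AE borel_measurable_integrable[OF Bochner_Integration.integrable_sum]
            borel_measurable_times borel_measurable_scaleR) auto
      also have "\<dots> = (\<Sum>h\<in>freqs k. \<integral>x. chi p (head k h) t * (f x * cnj (chi p (head k h) x)) \<partial>?\<mu>)"
        by (intro Bochner_Integration.integral_sum S_int)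
      also have "\<dots> = 0"
        by (intro sum.neutral ballI) (simp add: orth[OF head_freqs])
      finally have "?N * (\<integral>x\<in>?A. f x \<partial>?\<mu>) = 0"
        unfolding set_lebesgue_integral_def by (simp only: integral_mult_right_zero)
      then show ?thesis using N by simp
    qed
  qed
qed

lemma spectral_fill_measure: "spectral_with p (fill_measure p J \<phi>) (Lam p (- J))"
  unfolding spectral_with_def
  using chi_orthogonal chi_norm_integral chi_complete fill_chi_measurable by auto

end

theorem theorem7p1:
  fixes p :: nat and I J :: "nat set" and \<phi> :: "nat \<Rightarrow> nat list \<Rightarrow> nat"
  assumes "prime p"
    and "I \<inter> J = {}" and "I \<union> J = UNIV" and "infinite I" and "infinite J"
    and "\<forall>j\<in>J. \<forall>ts. length ts = j \<and> set ts \<subseteq> {..<p} \<longrightarrow> \<phi> j ts < p"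
  shows "(\<forall>g. Omega p J \<phi> (Suc g) \<subseteq> Omega p J \<phi> g) \<and>
         (\<exists>\<mu>. prob_space \<mu> \<and> sets \<mu> = sets (Haar p) \<and>
              weak_conv_Zp p (\<lambda>g. uniform_measure (Haar p) (Omega p J \<phi> g)) \<mu> \<and>
              singular \<mu> (Haar p) \<and>
              spectral_with p \<mu> (Lam p I))"
proof -
  interpret digit_rule p J \<phi>
    using assms(1,6) by unfold_locales (use prime_gt_1_nat in auto)
  have "I = - J" using assms(2,3) by auto
  then show ?thesis
    using Omega_Suc_subset prob_space_fill_measure sets_fill_measure weak_conv_fill_measure
      singular_fill_measure[OF assms(5)] spectral_fill_measure by blast
qed

end
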